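(* Let $r,s,t$ be positive integers with $r\neq t$, and let $\varphi:\mathbb{R}_+^6\to\mathbb{R}_+^6$ be the map $$\varphi(x_1,\ldots,x_6)=(x_3,x_4,x_5,x_6,x_7,x_8),\quad x_7=\frac{x_2^rx_4^{r+t}x_6^t+x_3^sx_5^s}{x_1},\quad x_8=\frac{x_3^tx_5^{r+t}x_7^r+x_4^sx_6^s}{x_2}.$$ Then $\varphi$ is a Poisson map with respect to the Poisson bracket on $\mathbb{R}_+^6$ given by $\{x_i,x_j\}=c_{ij}x_ix_j$, $i,j\in\{1,\ldots,6\}$, where $$C=[c_{ij}]=\begin{bmatrix}0&1&0&-1&0&1\\-1&0&1&0&-1&0\\0&-1&0&1&0&-1\\1&0&-1&0&1&0\\0&1&0&-1&0&1\\-1&0&1&0&-1&0\end{bmatrix}.$$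
   Context: $\mathbb{R}_+$ denotes the positive reals. A map $\varphi:M\to M$ is a Poisson map with respect to a Poisson bracket $\{\,,\}$ on $M$ if $\{f\circ\varphi,g\circ\varphi\}=\{f,g\}\circ\varphi$ for all $f,g\in C^\infty(M)$. For a skew-symmetric matrix $C$, the relations $\{x_i,x_j\}=c_{ij}x_ix_j$ on the coordinate functions determine the Poisson bracket on $C^\infty(\mathbb{R}_+^N)$ through $\{f,g\}=\sum_{i,j}c_{ij}x_ix_j\frac{\partial f}{\partial x_i}\frac{\partial g}{\partial x_j}$. *)

theory Defs
  imports "HOL-Analysis.Analysis"
begin

definition partial_deriv :: "'n::finite \<Rightarrow> (real^'n \<Rightarrow> real) \<Rightarrow> real^'n \<Rightarrow> real" where
  "partial_deriv i f x = deriv (\<lambda>h. f (x + h *\<^sub>R axis i 1)) 0"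

(* For open M.  Since M is open, the partial derivatives at points of M do not depend on
   the (arbitrary) values of f outside M, so total functions can represent functions on M. *)
primrec Ck_on :: "nat \<Rightarrow> (real^'n::finite) set \<Rightarrow> (real^'n \<Rightarrow> real) \<Rightarrow> bool" where
  "Ck_on 0 M f \<longleftrightarrow> continuous_on M f"
| "Ck_on (Suc k) M f \<longleftrightarrow>
     (\<forall>x\<in>M. f differentiable (at x)) \<and> (\<forall>i. Ck_on k M (partial_deriv i f))"

definition smooth_on :: "(real^'n::finite) set \<Rightarrow> (real^'n \<Rightarrow> real) \<Rightarrow> bool" where
  "smooth_on M f \<longleftrightarrow> (\<forall>k. Ck_on k M f)"

(* Smoothness of the components is what makes f o \<phi> an admissible argument of the bracket
   for every smooth f. *)
definition poisson_map ::
    "(real^'n::finite) set \<Rightarrow> ((real^'n \<Rightarrow> real) \<Rightarrow> (real^'n \<Rightarrow> real) \<Rightarrow> real^'n \<Rightarrow> real)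
      \<Rightarrow> (real^'n \<Rightarrow> real^'n) \<Rightarrow> bool" where
  "poisson_map M bracket \<phi> \<longleftrightarrow>
     \<phi> \<in> M \<rightarrow> M \<and> (\<forall>i. smooth_on M (\<lambda>x. \<phi> x $ i)) \<and>
     (\<forall>f g. smooth_on M f \<longrightarrow> smooth_on M g \<longrightarrow>
        (\<forall>x\<in>M. bracket (f \<circ> \<phi>) (g \<circ> \<phi>) x = bracket f g (\<phi> x)))"

definition positive_orthant :: "(real^'n::finite) set" where
  "positive_orthant = {x. \<forall>i. 0 < x $ i}"

definition log_canonical_bracket ::
    "real^'n^'n \<Rightarrow> (real^'n::finite \<Rightarrow> real) \<Rightarrow> (real^'n \<Rightarrow> real) \<Rightarrow> real^'n \<Rightarrow> real" where
  "log_canonical_bracket C f g x =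
     (\<Sum>i\<in>UNIV. \<Sum>j\<in>UNIV.
        C $ i $ j * x $ i * x $ j * partial_deriv i f x * partial_deriv j g x)"

lemma partial_deriv_coord: "partial_deriv i (\<lambda>x. x $ k) x = (if k = i then 1 else 0)"
proof -
  have "((\<lambda>h. (x + h *\<^sub>R axis i 1) $ k) has_real_derivative (if k = i then 1 else 0)) (at 0)"
    by (auto simp: axis_def intro!: derivative_eq_intros)
  then show ?thesis
    unfolding partial_deriv_def by (rule DERIV_imp_deriv)
qed

lemma log_canonical_bracket_coords:
  "log_canonical_bracket C (\<lambda>x. x $ i) (\<lambda>x. x $ j) x = C $ i $ j * x $ i * x $ j"
proof -
  have delta: "(\<Sum>l\<in>UNIV. a l * (if m = l then 1 else 0)) = a m" for a :: "'a \<Rightarrow> real" and m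
  proof -
    have "(\<Sum>l\<in>UNIV. a l * (if m = l then 1 else 0)) = (\<Sum>l\<in>UNIV. if m = l then a l else 0)"
      by (rule sum.cong) auto
    then show ?thesis by simp
  qed
  have "log_canonical_bracket C (\<lambda>x. x $ i) (\<lambda>x. x $ j) x =
      (\<Sum>k\<in>UNIV. (C $ k $ j * x $ k * x $ j) * (if i = k then 1 else 0))"
    unfolding log_canonical_bracket_def partial_deriv_coord
      delta ..
  also have "\<dots> = C $ i $ j * x $ i * x $ j"
    by (rule delta)
  finally show ?thesis .
qed

(* In the index type 6 the numeral 6 denotes the element 0, distinct from 1, ..., 5, so that
   x $ 1, ..., x $ 6 are the six coordinates of x. *)
lemma exhaust_6: "x = 1 \<or> x = 2 \<or> x = 3 \<or> x = 4 \<or> x = 5 \<or> x = 6" for x :: 6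
proof (induct x)
  case (of_int z)
  then have "z = 0 \<or> z = 1 \<or> z = 2 \<or> z = 3 \<or> z = 4 \<or> z = 5" by simp arith
  then show ?case by auto
qed

lemma UNIV_6: "UNIV = {1, 2, 3, 4, 5, 6::6}"
  using exhaust_6 by auto

lemma vector_6 [simp]:
  "(vector [a, b, c, d, e, f] :: 'a::zero^6) $ 1 = a"
  "(vector [a, b, c, d, e, f] :: 'a::zero^6) $ 2 = b"
  "(vector [a, b, c, d, e, f] :: 'a::zero^6) $ 3 = c"
  "(vector [a, b, c, d, e, f] :: 'a::zero^6) $ 4 = d"
  "(vector [a, b, c, d, e, f] :: 'a::zero^6) $ 5 = e"
  "(vector [a, b, c, d, e, f] :: 'a::zero^6) $ 6 = f"
  unfolding vector_def by simp_all

definition phi_x7 :: "nat \<Rightarrow> nat \<Rightarrow> nat \<Rightarrow> real^6 \<Rightarrow> real" where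
  "phi_x7 r s t x =
     ((x $ 2) ^ r * (x $ 4) ^ (r + t) * (x $ 6) ^ t + (x $ 3) ^ s * (x $ 5) ^ s) / x $ 1"

definition phi_x8 :: "nat \<Rightarrow> nat \<Rightarrow> nat \<Rightarrow> real^6 \<Rightarrow> real" where
  "phi_x8 r s t x =
     ((x $ 3) ^ t * (x $ 5) ^ (r + t) * (phi_x7 r s t x) ^ r + (x $ 4) ^ s * (x $ 6) ^ s) / x $ 2"

definition phi :: "nat \<Rightarrow> nat \<Rightarrow> nat \<Rightarrow> real^6 \<Rightarrow> real^6" where
  "phi r s t x = vector [x $ 3, x $ 4, x $ 5, x $ 6, phi_x7 r s t x, phi_x8 r s t x]"

definition C_mat :: "real^6^6" where
  "C_mat = vector
     [vector [ 0,  1,  0, -1,  0,  1],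
      vector [-1,  0,  1,  0, -1,  0],
      vector [ 0, -1,  0,  1,  0, -1],
      vector [ 1,  0, -1,  0,  1,  0],
      vector [ 0,  1,  0, -1,  0,  1],
      vector [-1,  0,  1,  0, -1,  0]]"

end

theory Submission
  imports Defs
begin

text \<open>
  The matrix factors as \<open>C = u v\<^sup>T - v u\<^sup>T\<close> with \<open>u = (1,0,-1,0,1,0)\<close> and \<open>v = (0,1,0,-1,0,1)\<close>, so that
  \<open>{f, g} = U f \<cdot> V g - V f \<cdot> U g\<close> for the weighted Euler fields \<open>U = \<Sum>\<^sub>i u\<^sub>i x\<^sub>i \<partial>\<^sub>i\<close> and
  \<open>V = \<Sum>\<^sub>i v\<^sub>i x\<^sub>i \<partial>\<^sub>i\<close>. These generate the scalings \<open>x\<^sub>i \<mapsto> c\<^bsup>w\<^sub>i\<^esup> x\<^sub>i\<close> for \<open>w = u\<close> and \<open>w = v\<close>. The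
  numerators of \<open>x\<^sub>7\<close> and \<open>x\<^sub>8\<close> are invariant under them, hence \<open>\<phi>\<close> carries the scaling by \<open>c\<close> to
  the scaling by \<open>1/c\<close>. Thus \<open>\<phi>\<close> maps \<open>U\<close> to \<open>-U\<close> and \<open>V\<close> to \<open>-V\<close>, and the two signs cancel.
\<close>

section \<open>Smooth functions on open sets\<close>

text \<open>Chain rule along the line \<open>h \<mapsto> x + h *\<^sub>R axis i 1\<close>. It
  reduces every rule for partial derivatives below to the matching rule for total
  derivatives.\<close>

lemma partial_deriv_eqI:
  assumes "(f has_derivative D) (at x)"
  shows "partial_deriv i f x = D (axis i 1)"
proof -
  have lin: "linear D"
    using assms by (rule has_derivative_linear)
  have "((\<lambda>h. x + h *\<^sub>R axis i 1) has_derivative (\<lambda>h. h *\<^sub>R axis i 1)) (at 0)"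
    by (auto intro!: derivative_eq_intros)
  moreover have "(f has_derivative D) (at (x + 0 *\<^sub>R axis i 1))"
    using assms by simp
  ultimately have "((\<lambda>h. f (x + h *\<^sub>R axis i 1)) has_derivative (\<lambda>h. D (h *\<^sub>R axis i 1))) (at 0)"
    by (rule has_derivative_compose)
  then have "((\<lambda>h. f (x + h *\<^sub>R axis i 1)) has_real_derivative D (axis i 1)) (at 0)"
    by (simp add: has_field_derivative_def linear_cmul[OF lin] mult.commute[of _ "D _"])
  then show ?thesis
    unfolding partial_deriv_def by (rule DERIV_imp_deriv)
qed

text \<open>The derivative is linear, so its values on the axis vectors determine it; expand
  \<open>d\<close> in the standard basis.\<close>

lemma has_derivative_partial_deriv:
  fixes f :: "real^'n::finite \<Rightarrow> real"
  assumes "f differentiable (at x)"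
  shows "(f has_derivative (\<lambda>d. \<Sum>i\<in>UNIV. d $ i * partial_deriv i f x)) (at x)"
proof -
  obtain D where D: "(f has_derivative D) (at x)"
    using assms unfolding differentiable_def by blast
  have lin: "linear D"
    using D by (rule has_derivative_linear)
  have "D d = (\<Sum>i\<in>UNIV. d $ i * partial_deriv i f x)" for d
  proof -
    have "D d = D (\<Sum>i\<in>UNIV. d $ i *\<^sub>R axis i 1)"
      using basis_expansion[of d] by (simp only: scalar_mult_eq_scaleR)
    also have "\<dots> = (\<Sum>i\<in>UNIV. d $ i * partial_deriv i f x)"
      by (simp add: linear_sum[OF lin] linear_cmul[OF lin] partial_deriv_eqI[OF D])
    finally show ?thesis .
  qed
  then show ?thesis
    using D by (rule has_derivative_eq_rhs[rotated, OF ext])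
qed

lemma partial_deriv_cong_open:
  assumes "open M" "x \<in> M" "\<And>y. y \<in> M \<Longrightarrow> f y = g y"
  shows "partial_deriv i f x = partial_deriv i g x"
proof -
  have "((\<lambda>h. x + h *\<^sub>R axis i 1) \<longlongrightarrow> x + 0 *\<^sub>R axis i 1) (at (0::real))"
    by (intro tendsto_intros)
  then have "\<forall>\<^sub>F h in at 0. x + h *\<^sub>R axis i 1 \<in> M"
    using assms(1,2) by (intro topological_tendstoD) auto
  \<comment> \<open>The limit says nothing about \<open>h = 0\<close>; there the point is
    \<open>x\<close> itself, which lies in \<open>M\<close>.\<close>
  then have "\<forall>\<^sub>F h in nhds 0. x + h *\<^sub>R axis i 1 \<in> M"
    using assms(2) by (simp add: eventually_nhds_conv_at)
  then have "\<forall>\<^sub>F h in nhds 0. f (x + h *\<^sub>R axis i 1) = g (x + h *\<^sub>R axis i 1)"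
    by eventually_elim (rule assms(3))
  then show ?thesis
    unfolding partial_deriv_def by (rule deriv_cong_ev) simp
qed

text \<open>\<open>partial_deriv i f\<close> is a total function, while the sum, product and inverse
  rules identify it only at points of \<open>M\<close>. This lemma lets those formulas replace it in
  the inductions below.\<close>

lemma Ck_on_cong:
  assumes "open M" "\<And>x. x \<in> M \<Longrightarrow> f x = g x" "Ck_on k M f"
  shows "Ck_on k M g"
  using assms(2,3)
proof (induction k arbitrary: f g)
  case 0
  then show ?case
    by (simp add: continuous_on_cong[of M M f g])
next
  case (Suc k)
  have "g differentiable (at x)" if "x \<in> M" for x
  proof -
    have "f differentiable (at x)"
      using Suc.prems(2) \<open>x \<in> M\<close> by simp
    then obtain D where "(f has_derivative D) (at x)"
      unfolding differentiable_def by (rule exE)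
    then have "(g has_derivative D) (at x)"
      using assms(1) \<open>x \<in> M\<close> Suc.prems(1) by (rule has_derivative_transform_within_open)
    then show ?thesis
      by (rule differentiableI)
  qed
  moreover have "Ck_on k M (partial_deriv i g)" for i
  proof (rule Suc.IH)
    show "partial_deriv i f x = partial_deriv i g x" if "x \<in> M" for x
      using assms(1) that Suc.prems(1) by (rule partial_deriv_cong_open)
    show "Ck_on k M (partial_deriv i f)"
      using Suc.prems(2) by simp
  qed
  ultimately show ?case
    by simp
qed

text \<open>The product rule mixes \<open>f\<close> with its partial derivatives, so
  \<open>f\<close> has to be lowered to the order of the latter. The base case is that
  differentiability implies continuity.\<close>

lemma Ck_on_Suc_imp_Ck_on: "Ck_on (Suc k) M f \<Longrightarrow> Ck_on k M f"
proof (induction k arbitrary: f)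
  case 0
  then have "isCont f x" if "x \<in> M" for x
    using that by (simp add: differentiable_imp_continuous_within)
  then show ?case
    by (simp add: continuous_at_imp_continuous_on)
next
  case (Suc k)
  have "\<forall>x\<in>M. f differentiable (at x)" and "Ck_on (Suc k) M (partial_deriv i f)" for i
    using Suc.prems by simp_all
  with Suc.IH show ?case
    unfolding Ck_on.simps(2)[of k M f] by blast
qed

lemma Ck_on_const: "Ck_on k M (\<lambda>x :: real^'n::finite. a)"
proof (induction k arbitrary: a)
  case (Suc k)
  have "partial_deriv i (\<lambda>x :: real^'n. a) = (\<lambda>x. 0)" for i
    by (simp add: partial_deriv_def fun_eq_iff)
  then show ?case
    using Suc by simp
qed simp

lemma Ck_on_coord: "Ck_on k M (\<lambda>x :: real^'n::finite. x $ j)"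
proof (cases k)
  case (Suc l)
  have "(\<lambda>x :: real^'n. x $ j) differentiable (at x)" for x
    by (rule bounded_linear_imp_differentiable[OF bounded_linear_vec_nth])
  moreover have "partial_deriv i (\<lambda>x :: real^'n. x $ j) = (\<lambda>x. if j = i then 1 else 0)" for i
    by (simp add: partial_deriv_coord fun_eq_iff)
  ultimately show ?thesis
    using Suc by (simp add: Ck_on_const)
qed (auto intro: continuous_intros)

lemma Ck_on_add:
  assumes "open M"
  shows "Ck_on k M f \<Longrightarrow> Ck_on k M g \<Longrightarrow> Ck_on k M (\<lambda>x. f x + g x)"
proof (induction k arbitrary: f g)
  case 0
  then show ?case
    by (auto intro: continuous_intros)
next
  case (Suc k)
  have "Ck_on k M (partial_deriv i (\<lambda>x. f x + g x))" for i
  proof (rule Ck_on_cong[OF assms])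
    show "Ck_on k M (\<lambda>x. partial_deriv i f x + partial_deriv i g x)"
      using Suc by simp
    show "partial_deriv i f x + partial_deriv i g x = partial_deriv i (\<lambda>x. f x + g x) x"
      if "x \<in> M" for x
    proof -
      obtain F G where F: "(f has_derivative F) (at x)" and G: "(g has_derivative G) (at x)"
        using Suc.prems \<open>x \<in> M\<close> by (metis Ck_on.simps(2) differentiable_def)
      show ?thesis
        by (simp add: partial_deriv_eqI[OF F] partial_deriv_eqI[OF G]
            partial_deriv_eqI[OF has_derivative_add[OF F G]])
    qed
  qed
  then show ?case
    using Suc.prems by (auto intro: differentiable_add)
qed

lemma Ck_on_mult:
  assumes "open M"
  shows "Ck_on k M f \<Longrightarrow> Ck_on k M g \<Longrightarrow> Ck_on k M (\<lambda>x. f x * g x)"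
proof (induction k arbitrary: f g)
  case 0
  then show ?case
    by (auto intro: continuous_intros)
next
  case (Suc k)
  have "Ck_on k M (partial_deriv i (\<lambda>x. f x * g x))" for i
  proof (rule Ck_on_cong[OF assms])
    show "Ck_on k M (\<lambda>x. f x * partial_deriv i g x + partial_deriv i f x * g x)"
      using Suc.prems Suc.prems[THEN Ck_on_Suc_imp_Ck_on]
      by (intro Ck_on_add[OF assms] Suc.IH) auto
    show "f x * partial_deriv i g x + partial_deriv i f x * g x = partial_deriv i (\<lambda>x. f x * g x) x"
      if "x \<in> M" for x
    proof -
      obtain F G where F: "(f has_derivative F) (at x)" and G: "(g has_derivative G) (at x)"
        using Suc.prems \<open>x \<in> M\<close> by (metis Ck_on.simps(2) differentiable_def)
      show ?thesis
        by (simp add: partial_deriv_eqI[OF F] partial_deriv_eqI[OF G]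
            partial_deriv_eqI[OF has_derivative_mult[OF F G]])
    qed
  qed
  then show ?case
    using Suc.prems by (auto intro: differentiable_mult)
qed

lemma Ck_on_inverse:
  assumes "open M" "\<And>x. x \<in> M \<Longrightarrow> f x \<noteq> 0" "Ck_on k M f"
  shows "Ck_on k M (\<lambda>x. inverse (f x))"
  using assms(3)
proof (induction k)
  case 0
  then show ?case
    using assms(2) by (auto intro: continuous_intros)
next
  case (Suc k)
  have "Ck_on k M (partial_deriv i (\<lambda>x. inverse (f x)))" for i
  proof (rule Ck_on_cong[OF assms(1)])
    \<comment> \<open>The derivative \<open>- f' / f^2\<close> is arranged as a product in which
      \<open>f\<close> occurs only through \<open>inverse (f x)\<close>, to which the induction
      hypothesis applies.\<close>
    show "Ck_on k M (\<lambda>x. - 1 * (inverse (f x) * partial_deriv i f x * inverse (f x)))"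
      using Suc.prems Suc.prems[THEN Ck_on_Suc_imp_Ck_on]
      by (intro Ck_on_mult[OF assms(1)] Suc.IH Ck_on_const) auto
    show "- 1 * (inverse (f x) * partial_deriv i f x * inverse (f x)) =
        partial_deriv i (\<lambda>x. inverse (f x)) x" if "x \<in> M" for x
    proof -
      obtain F where F: "(f has_derivative F) (at x)"
        using Suc.prems \<open>x \<in> M\<close> by (metis Ck_on.simps(2) differentiable_def)
      show ?thesis
        by (simp add: partial_deriv_eqI[OF F]
            partial_deriv_eqI[OF Deriv.has_derivative_inverse[OF assms(2)[OF that] F]])
    qed
  qed
  then show ?case
    using Suc.prems assms(2) by (auto intro: differentiable_inverse)
qed

lemma smooth_on_coord: "smooth_on M (\<lambda>x. x $ j)"
  by (simp add: smooth_on_def Ck_on_coord)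

lemma smooth_on_add:
  "open M \<Longrightarrow> smooth_on M f \<Longrightarrow> smooth_on M g \<Longrightarrow> smooth_on M (\<lambda>x. f x + g x)"
  by (simp add: smooth_on_def Ck_on_add)

lemma smooth_on_mult:
  "open M \<Longrightarrow> smooth_on M f \<Longrightarrow> smooth_on M g \<Longrightarrow> smooth_on M (\<lambda>x. f x * g x)"
  by (simp add: smooth_on_def Ck_on_mult)

lemma smooth_on_divide:
  "open M \<Longrightarrow> smooth_on M f \<Longrightarrow> smooth_on M g \<Longrightarrow> (\<And>x. x \<in> M \<Longrightarrow> g x \<noteq> 0) \<Longrightarrow>
    smooth_on M (\<lambda>x. f x / g x)"
  by (simp add: smooth_on_def divide_inverse Ck_on_mult Ck_on_inverse)

lemma smooth_on_power:
  assumes "open M" "smooth_on M f"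
  shows "smooth_on M (\<lambda>x. f x ^ n)"
proof (induction n)
  case 0
  then show ?case
    by (simp add: smooth_on_def Ck_on_const)
next
  case (Suc n)
  then show ?case
    using assms by (simp add: smooth_on_mult)
qed

lemma smooth_on_imp_differentiable: "smooth_on M f \<Longrightarrow> x \<in> M \<Longrightarrow> f differentiable (at x)"
  unfolding smooth_on_def by (metis Ck_on.simps(2))

lemma differentiable_vec_nth:
  fixes F :: "'a::real_normed_vector \<Rightarrow> real^'n::finite"
  assumes "\<And>i. (\<lambda>x. F x $ i) differentiable (at x)"
  shows "F differentiable (at x)"
proof -
  have "(\<lambda>x. \<Sum>i\<in>UNIV. F x $ i *\<^sub>R axis i (1::real)) differentiable (at x)"
    using assms by (intro differentiable_sum differentiable_scaleR) auto
  moreover have "(\<Sum>i\<in>UNIV. F x $ i *\<^sub>R axis i 1) = F x" for x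
    using basis_expansion[of "F x"] by (simp only: scalar_mult_eq_scaleR)
  ultimately show ?thesis
    by simp
qed

section \<open>Weighted scalings and Euler fields\<close>

definition scaling :: "int^'n \<Rightarrow> real \<Rightarrow> real^'n::finite \<Rightarrow> real^'n" where
  "scaling w c x = (\<chi> i. c powi (w $ i) * x $ i)"

definition euler :: "int^'n \<Rightarrow> (real^'n::finite \<Rightarrow> real) \<Rightarrow> real^'n \<Rightarrow> real" where
  "euler w f x = (\<Sum>i\<in>UNIV. of_int (w $ i) * x $ i * partial_deriv i f x)"

lemma scaling_1 [simp]: "scaling w 1 x = x"
  by (simp add: scaling_def vec_eq_iff)

text \<open>The curve \<open>c \<mapsto> scaling w c x\<close> passes through \<open>x\<close> at
  \<open>c = 1\<close> with velocity components \<open>w $ i * x $ i\<close>, since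
  \<open>c powi n\<close> has derivative \<open>n\<close> at 1.\<close>

lemma DERIV_scaling:
  fixes f :: "real^'n::finite \<Rightarrow> real"
  assumes "f differentiable (at x)"
  shows "((\<lambda>c. f (scaling w c x)) has_real_derivative euler w f x) (at 1)"
proof -
  have "((\<lambda>c. c powi (w $ i) * x $ i) has_derivative (\<lambda>h. h * (of_int (w $ i) * x $ i))) (at 1)" for i
    by (auto intro!: derivative_eq_intros)
  then have "((\<lambda>c. scaling w c x) has_derivative (\<lambda>h. h *\<^sub>R (\<chi> i. of_int (w $ i) * x $ i))) (at 1)"
    unfolding scaling_def
    by (intro has_derivative_componentwise_within[THEN iffD2])
      (auto simp: Basis_vec_def inner_axis)
  moreover have "(f has_derivative (\<lambda>d. \<Sum>i\<in>UNIV. d $ i * partial_deriv i f x)) (at (scaling w 1 x))"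
    using has_derivative_partial_deriv[OF assms] by simp
  ultimately have "((\<lambda>c. f (scaling w c x)) has_derivative
      (\<lambda>h. \<Sum>i\<in>UNIV. (h *\<^sub>R (\<chi> i. of_int (w $ i) * x $ i)) $ i * partial_deriv i f x)) (at 1)"
    by (rule has_derivative_compose)
  also have "(\<lambda>h. \<Sum>i\<in>UNIV. (h *\<^sub>R (\<chi> i. of_int (w $ i) * x $ i)) $ i * partial_deriv i f x) =
      (*) (euler w f x)"
    by (simp add: fun_eq_iff euler_def sum_distrib_left mult_ac)
  finally show ?thesis
    by (simp add: has_field_derivative_def)
qed

text \<open>The function \<open>c \<mapsto> f (F (scaling w c x))\<close> is differentiated at 1 in
  two ways: directly, and after moving the scaling past \<open>F\<close>. The minus sign is the
  derivative of \<open>inverse\<close> at 1.\<close>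

lemma euler_comp_inverse_scaling:
  assumes "F differentiable (at x)" "f differentiable (at (F x))"
    and equiv: "\<And>c. c > 0 \<Longrightarrow> F (scaling w c x) = scaling w (inverse c) (F x)"
  shows "euler w (f \<circ> F) x = - euler w f (F x)"
proof -
  have "((\<lambda>c. (f \<circ> F) (scaling w c x)) has_real_derivative euler w (f \<circ> F) x) (at 1)"
    by (intro DERIV_scaling differentiable_chain_at assms)
  moreover have "((\<lambda>c. (f \<circ> F) (scaling w c x)) has_real_derivative - euler w f (F x)) (at 1)"
  \<comment> \<open>Equivariance is known only for \<open>c > 0\<close>, which is an open
    neighbourhood of 1.\<close>
  proof (rule has_field_derivative_transform_within_open[where S = "{0<..}"])
    have inv: "(inverse has_real_derivative - 1) (at (1::real))"
      by (auto intro!: derivative_eq_intros)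
    have "((\<lambda>c. f (scaling w c (F x))) has_real_derivative euler w f (F x)) (at (inverse 1))"
      using DERIV_scaling[OF assms(2)] by simp
    from DERIV_chain2[OF this inv]
    show "((\<lambda>c. f (scaling w (inverse c) (F x))) has_real_derivative - euler w f (F x)) (at 1)"
      by simp
  qed (auto simp: equiv)
  ultimately show ?thesis
    by (rule DERIV_unique)
qed

text \<open>Each of the two rank-one parts of \<open>C\<close> turns the double sum into a product
  of two single sums.\<close>

lemma log_canonical_bracket_wedge:
  assumes "\<And>i j. C $ i $ j = of_int (u $ i * v $ j - v $ i * u $ j)"
  shows "log_canonical_bracket C f g x = euler u f x * euler v g x - euler v f x * euler u g x"
  unfolding log_canonical_bracket_def euler_def sum_product sum_subtractf[symmetric]
  by (intro sum.cong refl) (simp add: assms algebra_simps)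

section \<open>The map\<close>

lemma open_positive_orthant: "open (positive_orthant :: (real^'n::finite) set)"
proof -
  have "positive_orthant = (\<Inter>i. {x :: real^'n. 0 < x $ i})"
    by (auto simp: positive_orthant_def)
  also have "open \<dots>"
    by (intro open_INT finite ballI open_Collect_less continuous_intros)
  finally show ?thesis .
qed

text \<open>The negative of the second row of \<open>C_mat\<close>; \<open>even_weight\<close> is
  the first row. Together they span the row space.\<close>

definition odd_weight :: "int^6" where
  "odd_weight = vector [1, 0, - 1, 0, 1, 0]"

definition even_weight :: "int^6" where
  "even_weight = vector [0, 1, 0, - 1, 0, 1]"

lemma C_mat_wedge:
  "C_mat $ i $ j =
    of_int (odd_weight $ i * even_weight $ j - even_weight $ i * odd_weight $ j)"
  using exhaust_6[of i] exhaust_6[of j]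
  by (elim disjE) (simp_all add: C_mat_def odd_weight_def even_weight_def)

lemma all_6: "(\<forall>i::6. P i) \<longleftrightarrow> P 1 \<and> P 2 \<and> P 3 \<and> P 4 \<and> P 5 \<and> P 6"
  using exhaust_6 by metis

lemma phi_x7_pos:
  assumes "x \<in> positive_orthant"
  shows "phi_x7 r s t x > 0"
  using assms by (auto simp: phi_x7_def positive_orthant_def all_6 intro!: divide_pos_pos add_pos_pos)

lemma phi_x8_pos:
  assumes "x \<in> positive_orthant"
  shows "phi_x8 r s t x > 0"
  using assms phi_x7_pos[OF assms]
  by (auto simp: phi_x8_def positive_orthant_def all_6 intro!: divide_pos_pos add_pos_pos)

lemma phi_in_positive_orthant:
  "x \<in> positive_orthant \<Longrightarrow> phi r s t x \<in> positive_orthant"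
  using phi_x7_pos[of x r s t] phi_x8_pos[of x r s t]
  by (simp add: positive_orthant_def all_6 phi_def)

lemma smooth_on_phi: "smooth_on positive_orthant (\<lambda>x. phi r s t x $ i)"
proof -
  have nz: "x $ j \<noteq> 0" if "x \<in> positive_orthant" for x :: "real^6" and j
    using that by (auto simp: positive_orthant_def dest: spec[of _ j])
  note intros = smooth_on_divide smooth_on_add smooth_on_mult smooth_on_power smooth_on_coord
    open_positive_orthant nz
  have x7: "smooth_on positive_orthant (phi_x7 r s t)"
    unfolding phi_x7_def[abs_def] by (intro intros)
  have x8: "smooth_on positive_orthant (phi_x8 r s t)"
    unfolding phi_x8_def[abs_def] by (intro intros x7)
  show ?thesis
    using exhaust_6[of i] by (elim disjE) (simp_all add: phi_def smooth_on_coord x7 x8)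
qed

text \<open>Count weights: \<open>x3^s x5^s\<close> has weight \<open>-s + s = 0\<close> and even
  coordinates have weight 0, so dividing by \<open>x1\<close> gives \<open>x7\<close> weight -1.
  Then \<open>x3^t x5^(r+t) x7^r\<close> has weight \<open>-t + (r+t) - r = 0\<close>, and so has
  \<open>x8\<close>. The image weights \<open>(-1,0,1,0,-1,0)\<close> are the negated original
  ones.\<close>

lemma phi_scaling_odd_weight:
  assumes "c > 0"
  shows "phi r s t (scaling odd_weight c x) = scaling odd_weight (inverse c) (phi r s t x)"
proof -
  have x7: "phi_x7 r s t (scaling odd_weight c x) = phi_x7 r s t x / c"
    using assms by (simp add: phi_x7_def scaling_def odd_weight_def power_int_minus field_simps)
  have x8: "phi_x8 r s t (scaling odd_weight c x) = phi_x8 r s t x"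
    using assms by (simp add: phi_x8_def x7)
      (simp add: scaling_def odd_weight_def power_int_minus power_add field_simps)
  show ?thesis
    by (simp add: vec_eq_iff all_6 phi_def x7 x8)
      (simp add: scaling_def odd_weight_def power_int_minus field_simps)
qed

text \<open>Here \<open>x2^r x4^(r+t) x6^t\<close> has weight \<open>r - (r+t) + t = 0\<close>, so
  \<open>x7\<close> has weight 0. The term \<open>x4^s x6^s\<close> also has weight 0, and dividing
  by \<open>x2\<close> gives \<open>x8\<close> weight -1.\<close>

lemma phi_scaling_even_weight:
  assumes "c > 0"
  shows "phi r s t (scaling even_weight c x) = scaling even_weight (inverse c) (phi r s t x)"
proof -
  have x7: "phi_x7 r s t (scaling even_weight c x) = phi_x7 r s t x"
    using assms
    by (simp add: phi_x7_def scaling_def even_weight_def power_int_minus power_add field_simps)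
  have x8: "phi_x8 r s t (scaling even_weight c x) = phi_x8 r s t x / c"
    using assms by (simp add: phi_x8_def x7)
      (simp add: scaling_def even_weight_def power_int_minus field_simps)
  show ?thesis
    by (simp add: vec_eq_iff all_6 phi_def x7 x8)
      (simp add: scaling_def even_weight_def power_int_minus field_simps)
qed

theorem mainTheorem4:
  fixes r s t :: nat
  assumes "r > 0" and "s > 0" and "t > 0" and "r \<noteq> t"
  shows "poisson_map positive_orthant (log_canonical_bracket C_mat) (phi r s t)"
proof -
  have "log_canonical_bracket C_mat (f \<circ> phi r s t) (g \<circ> phi r s t) x =
      log_canonical_bracket C_mat f g (phi r s t x)"
    if f: "smooth_on positive_orthant f" and g: "smooth_on positive_orthant g"
      and x: "x \<in> positive_orthant" for f g x
  proof -
    have phi: "phi r s t differentiable (at x)"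
      by (intro differentiable_vec_nth smooth_on_imp_differentiable[OF smooth_on_phi x])
    note diff = smooth_on_imp_differentiable[OF _ phi_in_positive_orthant[OF x]]
    note odd = euler_comp_inverse_scaling[OF phi diff phi_scaling_odd_weight]
    note even = euler_comp_inverse_scaling[OF phi diff phi_scaling_even_weight]
    show ?thesis
      \<comment> \<open>Every term is a product of one odd and one even Euler derivative, and each
        factor changes sign under \<open>phi\<close>.\<close>
      by (simp add: log_canonical_bracket_wedge[OF C_mat_wedge] odd even f g)
  qed
  then show ?thesis
    by (simp add: poisson_map_def phi_in_positive_orthant smooth_on_phi)
qed

end
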